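(* Let $(X,d)$ be a metric space, and let $f:(X,d)\to (X,d)$ be a continuous map. Let $S(X)$ be the set of all continuous maps $X\to X$ and let $F_f:S(X)\to S(X)$ be given by $F_f(g)=f\circ g$. Let $S_k(X)$ and $S_p(X)$ denote $S(X)$ endowed with the compact-open topology and with the point-open topology, respectively. Then the following are equivalent: 1. $f$ is chaotic (in the sense of Devaney); 2. $F_f:S_k(X)\to S_k(X)$ is lightly chaotic with respect to the canonical subbase $\mathcal{S}_k=\{[K,G] : K\subset X \text{ compact},\ G\subset X \text{ open}\}$; 3. $F_f:S_p(X)\to S_p(X)$ is lightly chaotic with respect to the canonical subbase $\mathcal{S}_p=\{[\{x\},G] : x\in X,\ G\subset X \text{ open}\}$.
   Context: For $K\subset X$ and $G\subset X$, $[K,G]=\{g\in S(X): g(K)\subset G\}$. The compact-open topology on $S(X)$ is the topology generated by the subbase $\mathcal{S}_k$, and the point-open topology (topology of pointwise convergence) is the one generated by the subbase $\mathcal{S}_p$. The map $F_f$ is continuous for both topologies. Iterates: $f^0=\mathrm{id}_X$, $f^{n+1}=f^n\circ f$. A point $x$ is periodic for $f$ if $f^k(x)=x$ for some integer $k\ge 1$. A continuous map $f:X\to X$ is (topologically) transitive if for every pair of nonempty open sets $U,V$ there is a positive integer $k$ with $f^k(U)\cap V\neq\emptyset$. It is periodically dense if the set of its periodic points is dense in $X$. A continuous self-map $f$ of a metric space $(X,d)$ is sensitive if there is $\delta>0$ such that for every $x\in X$ and every neighborhood $V$ of $x$ there exist $y\in V$ and an integer $k\ge 1$ with $d(f^k(x),f^k(y))\ge\delta$.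 It is chaotic (in the sense of Devaney) if it is transitive, periodically dense and sensitive. Let $Y$ be a topological space, $\mathcal{S}$ a subbase for $Y$, and $\varphi:Y\to Y$ a continuous map. Then $\varphi$ is lightly chaotic with respect to $\mathcal{S}$ if both of the following hold: (LC1) for every $U,V\in\mathcal{S}\setminus\{\emptyset\}$ there exists a positive integer $k$ with $\varphi^k(U)\cap V\neq\emptyset$; (LC2) every $U\in\mathcal{S}\setminus\{\emptyset\}$ contains a periodic point of $\varphi$.
   Formalization: It is additionally assumed that X is not the orbit of a single periodic point of f; in that case (e.g. a one-point space) conditions 2 and 3 hold but f is not sensitive, so the equivalence with condition 1 fails. *)

theory Defs
  imports "HOL-Analysis.Analysis"
begin

definition periodic_point :: "('a \<Rightarrow> 'a) \<Rightarrow> 'a \<Rightarrow> bool" where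
  "periodic_point f x \<longleftrightarrow> (\<exists>k\<ge>1. (f ^^ k) x = x)"

definition transitive :: "('a::topological_space \<Rightarrow> 'a) \<Rightarrow> bool" where
  "transitive f \<longleftrightarrow> continuous_on UNIV f \<and>
     (\<forall>U V. open U \<and> U \<noteq> {} \<and> open V \<and> V \<noteq> {} \<longrightarrow> (\<exists>k>0. (f ^^ k) ` U \<inter> V \<noteq> {}))"

definition periodically_dense :: "('a::topological_space \<Rightarrow> 'a) \<Rightarrow> bool" where
  "periodically_dense f \<longleftrightarrow> closure {x. periodic_point f x} = UNIV"

text \<open>\<open>x \<in> interior V\<close> says that \<open>V\<close> is a (not necessarily open) neighbourhood of \<open>x\<close>.\<close>

definition sensitive :: "('a::metric_space \<Rightarrow> 'a) \<Rightarrow> bool" where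
  "sensitive f \<longleftrightarrow> continuous_on UNIV f \<and>
     (\<exists>\<delta>>0. \<forall>x V. x \<in> interior V \<longrightarrow>
        (\<exists>y\<in>V. \<exists>k\<ge>1. dist ((f ^^ k) x) ((f ^^ k) y) \<ge> \<delta>))"

definition devaney_chaotic :: "('a::metric_space \<Rightarrow> 'a) \<Rightarrow> bool" where
  "devaney_chaotic f \<longleftrightarrow> transitive f \<and> periodically_dense f \<and> sensitive f"

text \<open>The first two conjuncts are the standing assumptions under which light chaos is defined:
  \<open>\<S>\<close> is a subbase of the space \<open>Y\<close>, and \<open>\<phi>\<close> is a continuous self-map of \<open>Y\<close>.\<close>

definition lightly_chaotic :: "'b topology \<Rightarrow> 'b set set \<Rightarrow> ('b \<Rightarrow> 'b) \<Rightarrow> bool" where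
  "lightly_chaotic Y \<S> \<phi> \<longleftrightarrow>
     Y = topology_generated_by \<S> \<and> continuous_map Y Y \<phi> \<and>
     (\<forall>U\<in>\<S> - {{}}. \<forall>V\<in>\<S> - {{}}. \<exists>k>0. (\<phi> ^^ k) ` U \<inter> V \<noteq> {}) \<and>
     (\<forall>U\<in>\<S> - {{}}. \<exists>u\<in>U. periodic_point \<phi> u)"

definition cont_selfmaps :: "('a::topological_space \<Rightarrow> 'a) set" where
  "cont_selfmaps = {g. continuous_on UNIV g}"

definition maps_into :: "'a::topological_space set \<Rightarrow> 'a set \<Rightarrow> ('a \<Rightarrow> 'a) set" where
  "maps_into K G = {g \<in> cont_selfmaps. g ` K \<subseteq> G}"

definition compact_open_subbase :: "('a::topological_space \<Rightarrow> 'a) set set" where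
  "compact_open_subbase = {maps_into K G | K G. compact K \<and> open G}"

definition point_open_subbase :: "('a::topological_space \<Rightarrow> 'a) set set" where
  "point_open_subbase = {maps_into {x} G | x G. open G}"

text \<open>Both subbases contain \<open>cont_selfmaps\<close> (take \<open>G = UNIV\<close>), so it is the carrier of both
  topologies.\<close>

definition compact_open_topology :: "('a::topological_space \<Rightarrow> 'a) topology" where
  "compact_open_topology = topology_generated_by compact_open_subbase"

definition point_open_topology :: "('a::topological_space \<Rightarrow> 'a) topology" where
  "point_open_topology = topology_generated_by point_open_subbase"

definition post_comp :: "('a \<Rightarrow> 'a) \<Rightarrow> ('a \<Rightarrow> 'a) \<Rightarrow> ('a \<Rightarrow> 'a)" where
  "post_comp f g = f \<circ> g"

text \<open>The degenerate case in which the whole space is one (necessarily finite) periodic orbit.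
  There \<open>f\<close> is transitive and periodically dense, and \<open>post_comp f\<close> is lightly chaotic for both
  subbases, but \<open>f\<close> is not sensitive, since a finite metric space is discrete. The
  simplest instance is the one-point space. It therefore has to be excluded when
  Devaney chaos is characterised by light chaos.\<close>

definition single_periodic_orbit :: "('a \<Rightarrow> 'a) \<Rightarrow> bool" where
  "single_periodic_orbit f \<longleftrightarrow> (\<exists>x. periodic_point f x \<and> range (\<lambda>n. (f ^^ n) x) = UNIV)"

end

theory Submission imports Defs begin

text \<open>Constant maps carry transitivity and density of periodic points from \<open>X\<close> to any subbase of
  sets \<open>[K, G]\<close>, and evaluation at a point carries them back; the choice of the sets \<open>K\<close> is
  irrelevant as long as some singleton is among them. What remains is the
  theorem of Banks, Brooks, Cairns, Davis and Stacey that transitivity and density of periodic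
  points imply sensitivity. If \<open>X\<close> is not one periodic orbit, there are two disjoint periodic orbits,
  so every point \<open>x\<close> stays uniformly away from some periodic orbit. Near \<open>x\<close> there are both a periodic
  point \<open>p\<close> and, by transitivity, a point \<open>y\<close> that later shadows the distant orbit
  for at least a full period of \<open>p\<close>; at a multiple of this period \<open>p\<close> is back near \<open>x\<close> while \<open>y\<close> is
  far away.\<close>

lemma continuous_on_funpow:
  fixes f :: "'a::topological_space \<Rightarrow> 'a"
  assumes "continuous_on UNIV f"
  shows "continuous_on UNIV (f ^^ n)"
proof (induction n)
  case (Suc n)
  then have "continuous_on UNIV (f \<circ> (f ^^ n))"
    by (intro continuous_on_compose continuous_on_subset[OF assms]) auto
  then show ?case by simp
qed (simp add: id_def)

lemma periodically_dense_iff: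
  "periodically_dense f \<longleftrightarrow> (\<forall>U. open U \<and> U \<noteq> {} \<longrightarrow> (\<exists>x\<in>U. periodic_point f x))"
proof
  assume "periodically_dense f"
  then show "\<forall>U. open U \<and> U \<noteq> {} \<longrightarrow> (\<exists>x\<in>U. periodic_point f x)"
    using open_Int_closure_eq_empty[of _ "{x. periodic_point f x}"]
    unfolding periodically_dense_def by fastforce
next
  let ?C = "closure {x. periodic_point f x}"
  assume R: "\<forall>U. open U \<and> U \<noteq> {} \<longrightarrow> (\<exists>x\<in>U. periodic_point f x)"
  have "open (- ?C)" by (simp add: open_Compl)
  with R have "- ?C = {}" using closure_subset[of "{x. periodic_point f x}"] by blast
  then show "periodically_dense f" unfolding periodically_dense_def by blast
qed

lemma post_comp_funpow: "(post_comp f ^^ n) g = (f ^^ n) \<circ> g"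
  by (induction n) (auto simp: post_comp_def)

lemma finite_periodic_orbit:
  assumes "periodic_point f x"
  shows "finite (range (\<lambda>n. (f ^^ n) x))"
proof -
  obtain k where k: "k \<ge> 1" "(f ^^ k) x = x"
    using assms by (auto simp: periodic_point_def)
  have "range (\<lambda>n. (f ^^ n) x) \<subseteq> (\<lambda>n. (f ^^ n) x) ` {..<k}"
  proof clarify
    fix n
    have "(f ^^ n) x = (f ^^ (n mod k)) x"
      using k by (simp add: funpow_mod_eq)
    then show "(f ^^ n) x \<in> (\<lambda>n. (f ^^ n) x) ` {..<k}" using k by auto
  qed
  then show ?thesis by (rule finite_subset) simp
qed

text \<open>Continuing from the \<open>n\<close>-th iterate until \<open>n\<close> full periods
  \<open>k\<close> are completed leads back to \<open>x\<close>. The subtraction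
  \<open>n * k - n\<close> is not truncated, because \<open>k \<ge> 1\<close>.\<close>

lemma periodic_orbit_reaches_start:
  assumes "periodic_point f x"
  obtains m where "(f ^^ m) ((f ^^ n) x) = x"
proof -
  obtain k where k: "k \<ge> 1" "(f ^^ k) x = x"
    using assms by (auto simp: periodic_point_def)
  have "(f ^^ (n * k - n)) ((f ^^ n) x) = (f ^^ (n * k)) x"
    using k(1) by (simp flip: funpow_add comp_apply[of "f ^^ (n * k - n)"])
  also have "\<dots> = x"
    using funpow_mod_eq[OF k(2), of "n * k"] by simp
  finally show ?thesis by (rule that)
qed

text \<open>A periodic orbit is finite, hence closed in a T1 space. If it contained every periodic
  point, density would make it the whole space, so some periodic point \<open>q\<close> lies off the
  orbit of \<open>p\<close>. Were the two orbits to meet, following the orbit of \<open>q\<close>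
  from the common point back to \<open>q\<close> would put \<open>q\<close> on the orbit of
  \<open>p\<close>.\<close>

lemma disjoint_periodic_orbits:
  fixes f :: "'a::t1_space \<Rightarrow> 'a"
  assumes "periodically_dense f" "\<not> single_periodic_orbit f"
  obtains p q where "periodic_point f p" "periodic_point f q"
    "range (\<lambda>n. (f ^^ n) p) \<inter> range (\<lambda>n. (f ^^ n) q) = {}"
proof -
  let ?P = "{x. periodic_point f x}" and ?O = "\<lambda>x. range (\<lambda>n. (f ^^ n) x)"
  have dense: "closure ?P = UNIV" using assms by (simp add: periodically_dense_def)
  then obtain p where p: "periodic_point f p"
    by (metis Collect_empty_eq closure_empty UNIV_not_empty)
  have "\<not> ?P \<subseteq> ?O p"
  proof
    assume "?P \<subseteq> ?O p"
    then have "closure ?P \<subseteq> ?O p"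
      by (intro closure_minimal finite_imp_closed finite_periodic_orbit p)
    with dense p assms(2) show False unfolding single_periodic_orbit_def by blast
  qed
  then obtain q where q: "periodic_point f q" "q \<notin> ?O p" by blast
  have "?O p \<inter> ?O q = {}"
  proof (rule ccontr)
    assume "?O p \<inter> ?O q \<noteq> {}"
    then obtain i j where ij: "(f ^^ i) p = (f ^^ j) q" by auto
    obtain m where "(f ^^ m) ((f ^^ j) q) = q"
      using periodic_orbit_reaches_start[OF q(1)] by blast
    then have "q = (f ^^ (m + i)) p" by (simp add: funpow_add ij)
    with q(2) show False by blast
  qed
  then show ?thesis using that p q(1) by blast
qed

text \<open>Two disjoint finite orbits have a positive distance \<open>d\<close>, and by the
  triangle inequality no point is closer than \<open>d / 2\<close> to both.\<close>

lemma uniformly_distant_periodic_orbit: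
  fixes f :: "'a::metric_space \<Rightarrow> 'a"
  assumes "periodically_dense f" "\<not> single_periodic_orbit f"
  obtains \<delta> where "\<delta> > 0" "\<And>x. \<exists>q. \<forall>n. dist x ((f ^^ n) q) \<ge> \<delta>"
proof -
  let ?O = "\<lambda>x. range (\<lambda>n. (f ^^ n) x)"
  obtain p q where pq: "periodic_point f p" "periodic_point f q" "?O p \<inter> ?O q = {}"
    using disjoint_periodic_orbits[OF assms] by blast
  define d where "d = Min ((\<lambda>(x, y). dist x y) ` (?O p \<times> ?O q))"
  have fin: "finite ((\<lambda>(x, y). dist x y) ` (?O p \<times> ?O q))"
    by (intro finite_imageI finite_cartesian_product finite_periodic_orbit pq)
  have "x \<noteq> y" if "x \<in> ?O p" "y \<in> ?O q" for x y
    using pq(3) that by blast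
  then have "d > 0" unfolding d_def using fin by (subst Min_gr_iff) auto
  moreover have "\<forall>x\<in>?O p. \<forall>y\<in>?O q. d \<le> dist x y"
    unfolding d_def by (intro ballI Min_le fin) auto
  ultimately have d: "d > 0" "\<forall>x\<in>?O p. \<forall>y\<in>?O q. d \<le> dist x y" by blast+
  have "\<exists>r. \<forall>n. dist x ((f ^^ n) r) \<ge> d / 2" for x
  proof (rule ccontr)
    assume "\<not> ?thesis"
    then obtain i j where "dist x ((f ^^ i) p) < d / 2" "dist x ((f ^^ j) q) < d / 2"
      by (meson not_le)
    then have "dist ((f ^^ i) p) ((f ^^ j) q) < d"
      by (rule dist_triangle_half_r)
    with d(2) show False by (meson not_le rangeI)
  qed
  with d(1) show ?thesis using that[of "d / 2"] by simp
qed

lemma transitive_periodically_dense_imp_sensitive: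
  fixes f :: "'a::metric_space \<Rightarrow> 'a"
  assumes "transitive f" "periodically_dense f" "\<not> single_periodic_orbit f"
  shows "sensitive f"
proof -
  have cont: "continuous_on UNIV f" using assms(1) by (simp add: transitive_def)
  obtain e where e: "e > 0" "\<And>x. \<exists>q. \<forall>n. dist x ((f ^^ n) q) \<ge> e"
    using uniformly_distant_periodic_orbit[OF assms(2,3)] by blast
  \<comment> \<open>Of the distance \<open>4 * d\<close> from \<open>x\<close> to the orbit of
    \<open>q\<close>, one \<open>d\<close> is lost between \<open>x\<close> and \<open>p\<close> and
    another in shadowing. The remaining \<open>2 * d\<close> is halved at the end, when
    \<open>p\<close> and \<open>y\<close> are compared with \<open>x\<close>.\<close>
  define d where "d = e / 4"
  have d: "d > 0" "e = 4 * d" using e by (auto simp: d_def)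
  have "\<exists>y\<in>N. \<exists>k\<ge>1. dist ((f ^^ k) x) ((f ^^ k) y) \<ge> d" if N: "x \<in> interior N" for x N
  proof -
    let ?U = "interior N \<inter> ball x d"
    have U: "open ?U" "x \<in> ?U" using N d by auto
    obtain p where p: "p \<in> ?U" "periodic_point f p"
      using assms(2) U unfolding periodically_dense_iff by blast
    then obtain n where n: "n \<ge> 1" "(f ^^ n) p = p" by (auto simp: periodic_point_def)
    obtain q where q: "\<And>i. dist x ((f ^^ i) q) \<ge> 4 * d" using e d by metis
    \<comment> \<open>The points that shadow the orbit of \<open>q\<close> up to time
      \<open>n\<close>, a period of \<open>p\<close>.\<close>
    let ?V = "\<Inter>i\<in>{..n}. (f ^^ i) -` ball ((f ^^ i) q) d"
    have "open ?V"
      using open_vimage[OF open_ball continuous_on_funpow[OF cont]] by (intro open_INT) auto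
    moreover have "q \<in> ?V" using d by auto
    ultimately obtain k where "(f ^^ k) ` ?U \<inter> ?V \<noteq> {}"
      using assms(1) U unfolding transitive_def by blast
    then obtain y where y: "y \<in> ?U" "(f ^^ k) y \<in> ?V" by blast
    \<comment> \<open>The least multiple of \<open>n\<close> exceeding \<open>k\<close>:
      \<open>p\<close> is back at its start at time \<open>m\<close>, and
      \<open>m - k = n - k mod n\<close> is at most \<open>n\<close>, so \<open>y\<close> is still
      shadowing then.\<close>
    define m where "m = n * (k div n + 1)"
    have "m + k mod n = k + n" "k mod n < n"
      using n mult_div_mod_eq[of n k] by (simp_all add: m_def distrib_left)
    then have km: "m = k + (n - k mod n)" "m \<ge> 1" by linarith+
    have "(f ^^ m) p = p"
      using funpow_mod_eq[OF n(2), of m] by (simp add: m_def)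
    moreover have "(f ^^ m) y = (f ^^ (n - k mod n)) ((f ^^ k) y)"
      unfolding km(1) by (subst add.commute) (simp add: funpow_add)
    then have "dist ((f ^^ (n - k mod n)) q) ((f ^^ m) y) < d"
      using y(2) by auto
    moreover have "dist x p < d" using p by auto
    ultimately have "dist ((f ^^ m) p) ((f ^^ m) y) > 2 * d"
      using q[of "n - k mod n"] dist_triangle[of x "(f ^^ (n - k mod n)) q" p]
        dist_triangle[of p "(f ^^ (n - k mod n)) q" "(f ^^ m) y"]
      by (simp add: dist_commute)
    \<comment> \<open>It is not known which of \<open>p\<close> and \<open>y\<close> separates from
      \<open>x\<close>, but both lie in \<open>N\<close>, so either may serve as witness.\<close>
    then have "dist ((f ^^ m) x) ((f ^^ m) p) \<ge> d \<or> dist ((f ^^ m) x) ((f ^^ m) y) \<ge> d"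
      using dist_triangle3[of "(f ^^ m) p" "(f ^^ m) y" "(f ^^ m) x"] by linarith
    moreover have "p \<in> N" "y \<in> N" using p y interior_subset by auto
    ultimately show ?thesis using km(2) by blast
  qed
  then show ?thesis using cont d(1) unfolding sensitive_def by blast
qed

text \<open>The compact sets give \<open>compact_open_subbase\<close> and the singletons give
  \<open>point_open_subbase\<close>, so one argument covers both topologies.\<close>

definition set_open_subbase :: "'a::topological_space set set \<Rightarrow> ('a \<Rightarrow> 'a) set set" where
  "set_open_subbase \<K> = {maps_into K G | K G. K \<in> \<K> \<and> open G}"

lemma continuous_map_post_comp:
  fixes f :: "'a::topological_space \<Rightarrow> 'a"
  assumes f: "continuous_on UNIV f" and "\<K> \<noteq> {}"
  shows "continuous_map (topology_generated_by (set_open_subbase \<K>))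
           (topology_generated_by (set_open_subbase \<K>)) (post_comp f)"
proof -
  have comp: "post_comp f g \<in> cont_selfmaps" if "g \<in> cont_selfmaps" for g
    using that f unfolding cont_selfmaps_def post_comp_def
    by (auto intro: continuous_on_compose2[of UNIV f])
  obtain K where "K \<in> \<K>" using assms(2) by blast
  then have "maps_into K UNIV \<in> set_open_subbase \<K>"
    unfolding set_open_subbase_def by blast
  then have un: "\<Union> (set_open_subbase \<K>) = cont_selfmaps"
    by (auto simp: set_open_subbase_def maps_into_def)
  have "openin (topology_generated_by (set_open_subbase \<K>)) (post_comp f -` U \<inter> cont_selfmaps)"
    if "U \<in> set_open_subbase \<K>" for U
  proof -
    obtain K G where KG: "U = maps_into K G" "K \<in> \<K>" "open G"
      using \<open>U \<in> _\<close> by (auto simp: set_open_subbase_def)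
    have "post_comp f -` U \<inter> cont_selfmaps = maps_into K (f -` G)"
      using comp by (auto simp: KG(1) maps_into_def post_comp_def)
    also have "\<dots> \<in> set_open_subbase \<K>"
      using KG open_vimage[OF KG(3) f] by (auto simp: set_open_subbase_def)
    finally show ?thesis by (rule topology_generated_by_Basis)
  qed
  then show ?thesis
    using comp by (auto simp: continuous_on_generated_topo_iff un)
qed

lemma const_in_maps_into: "a \<in> G \<Longrightarrow> (\<lambda>_. a) \<in> maps_into K G"
  by (auto simp: maps_into_def cont_selfmaps_def)

text \<open>A nonempty \<open>[K, G]\<close> may have \<open>G = {}\<close>, namely when \<open>K = {}\<close>; such a set is \<open>[K, UNIV]\<close>.\<close>

lemma set_open_subbase_contains_constants:
  assumes "U \<in> set_open_subbase \<K> - {{}}"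
  obtains G where "open G" "G \<noteq> {}" "\<And>a. a \<in> G \<Longrightarrow> (\<lambda>_. a) \<in> U"
proof -
  obtain K G where KG: "U = maps_into K G" "open G"
    using assms by (auto simp: set_open_subbase_def)
  show ?thesis
  proof (cases "G = {}")
    case True
    then have "K = {}" using assms KG by (auto simp: maps_into_def)
    then have "U = maps_into K UNIV" by (auto simp: KG(1) maps_into_def)
    then show ?thesis using that[of UNIV] by (auto intro: const_in_maps_into)
  qed (use KG that const_in_maps_into in blast)
qed

text \<open>The right-hand side does not mention \<open>\<K>\<close>, so any two families containing
  a singleton yield equivalent notions of light chaos for \<open>post_comp f\<close>.\<close>

lemma lightly_chaotic_iff:
  fixes f :: "'a::topological_space \<Rightarrow> 'a"
  assumes f: "continuous_on UNIV f" and a: "{a} \<in> \<K>"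
  shows "lightly_chaotic (topology_generated_by (set_open_subbase \<K>)) (set_open_subbase \<K>)
           (post_comp f) \<longleftrightarrow> transitive f \<and> periodically_dense f" (is "?L \<longleftrightarrow> ?R")
proof
  let ?S = "set_open_subbase \<K>"
  assume ?L
  then have LC1: "\<And>U V. U \<in> ?S - {{}} \<Longrightarrow> V \<in> ?S - {{}} \<Longrightarrow> \<exists>k>0. (post_comp f ^^ k) ` U \<inter> V \<noteq> {}"
    and LC2: "\<And>U. U \<in> ?S - {{}} \<Longrightarrow> \<exists>u\<in>U. periodic_point (post_comp f) u"
    unfolding lightly_chaotic_def by blast+
  have mem: "maps_into {a} G \<in> ?S - {{}}" if "open G" "G \<noteq> {}" for G
    using that a const_in_maps_into[of _ G "{a}"] unfolding set_open_subbase_def by blast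
  have "\<exists>k>0. (f ^^ k) ` U \<inter> V \<noteq> {}" if "open U" "U \<noteq> {}" "open V" "V \<noteq> {}" for U V
  proof -
    obtain k where k: "k > 0" "(post_comp f ^^ k) ` maps_into {a} U \<inter> maps_into {a} V \<noteq> {}"
      using LC1 mem \<open>open U\<close> \<open>U \<noteq> {}\<close> \<open>open V\<close> \<open>V \<noteq> {}\<close> by meson
    then obtain g where "g \<in> maps_into {a} U" "(f ^^ k) \<circ> g \<in> maps_into {a} V"
      by (auto simp: post_comp_funpow)
    then have "g a \<in> U" "(f ^^ k) (g a) \<in> V" by (auto simp: maps_into_def)
    with k(1) show ?thesis by blast
  qed
  then have "transitive f" using f by (simp add: transitive_def)
  moreover have "\<exists>x\<in>U. periodic_point f x" if U: "open U" "U \<noteq> {}" for U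
  proof -
    obtain g where g: "g \<in> maps_into {a} U" "periodic_point (post_comp f) g"
      using LC2 mem[OF U] by blast
    then have "periodic_point f (g a)"
      unfolding periodic_point_def post_comp_funpow by (metis comp_apply)
    with g(1) show ?thesis by (auto simp: maps_into_def)
  qed
  then have "periodically_dense f"
    unfolding periodically_dense_iff by blast
  ultimately show ?R by blast
next
  let ?S = "set_open_subbase \<K>"
  assume R: ?R
  have "\<exists>k>0. (post_comp f ^^ k) ` U \<inter> V \<noteq> {}" if U: "U \<in> ?S - {{}}" and V: "V \<in> ?S - {{}}" for U V
  proof -
    obtain G where G: "open G" "G \<noteq> {}" "\<And>a. a \<in> G \<Longrightarrow> (\<lambda>_. a) \<in> U"
      using set_open_subbase_contains_constants[OF U] by blast
    obtain H where H: "open H" "H \<noteq> {}" "\<And>a. a \<in> H \<Longrightarrow> (\<lambda>_. a) \<in> V"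
      using set_open_subbase_contains_constants[OF V] by blast
    obtain k where k: "k > 0" "(f ^^ k) ` G \<inter> H \<noteq> {}"
      using R G H unfolding transitive_def by blast
    then obtain x where x: "x \<in> G" "(f ^^ k) x \<in> H" by blast
    have "(post_comp f ^^ k) (\<lambda>_. x) = (\<lambda>_. (f ^^ k) x)"
      by (auto simp: post_comp_funpow)
    then have "(\<lambda>_. (f ^^ k) x) \<in> (post_comp f ^^ k) ` U \<inter> V"
      using G(3)[OF x(1)] H(3)[OF x(2)] by (metis IntI imageI)
    with k(1) show ?thesis by blast
  qed
  moreover have "\<exists>u\<in>U. periodic_point (post_comp f) u" if U: "U \<in> ?S - {{}}" for U
  proof -
    obtain G where G: "open G" "G \<noteq> {}" "\<And>a. a \<in> G \<Longrightarrow> (\<lambda>_. a) \<in> U"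
      using set_open_subbase_contains_constants[OF U] by blast
    obtain p where p: "p \<in> G" "periodic_point f p"
      using R G(1,2) unfolding periodically_dense_iff by blast
    then have "periodic_point (post_comp f) (\<lambda>_. p)"
      unfolding periodic_point_def post_comp_funpow by auto
    with G(3)[OF p(1)] show ?thesis by blast
  qed
  moreover have "\<K> \<noteq> {}" using a by blast
  ultimately show ?L
    using continuous_map_post_comp[OF f] unfolding lightly_chaotic_def by blast
qed

theorem theorem4p2:
  fixes f :: "'a::metric_space \<Rightarrow> 'a"
  assumes "continuous_on UNIV f"
    and "\<not> single_periodic_orbit f"
  shows "(devaney_chaotic f \<longleftrightarrow>
            lightly_chaotic compact_open_topology compact_open_subbase (post_comp f)) \<and>
         (lightly_chaotic compact_open_topology compact_open_subbase (post_comp f) \<longleftrightarrow>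
            lightly_chaotic point_open_topology point_open_subbase (post_comp f))"
proof -
  \<comment> \<open>Below, \<open>undefined\<close> only names some point of the type, whose
    singleton is compact.\<close>
  have "compact_open_subbase = set_open_subbase (Collect compact :: 'a set set)"
    by (simp add: compact_open_subbase_def set_open_subbase_def)
  then have compact_open: "lightly_chaotic compact_open_topology compact_open_subbase (post_comp f)
      \<longleftrightarrow> transitive f \<and> periodically_dense f"
    using lightly_chaotic_iff[OF assms(1), of undefined "Collect compact"]
    by (simp add: compact_open_topology_def)
  have "point_open_subbase = set_open_subbase (range (\<lambda>x::'a. {x}))"
    unfolding point_open_subbase_def set_open_subbase_def by blast
  then have point_open: "lightly_chaotic point_open_topology point_open_subbase (post_comp f)
      \<longleftrightarrow> transitive f \<and> periodically_dense f"
    using lightly_chaotic_iff[OF assms(1), of undefined "range (\<lambda>x. {x})"]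
    by (simp add: point_open_topology_def)
  \<comment> \<open>Devaney chaos adds only sensitivity to the common right-hand side, and it
    follows once a single periodic orbit is excluded.\<close>
  show ?thesis
    using compact_open point_open transitive_periodically_dense_imp_sensitive[of f] assms(2)
    unfolding devaney_chaotic_def by blast
qed

end
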